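(* Let $(A,\cdot,\alpha)$ be a regular Hom-pre-Malcev algebra with a Hessian structure $\mathcal{B}$, and assume that $(A^*,\ \mathrm{ad}^\star,\ -R_\cdot^\star,\ (\alpha^{-1})^* )$ is a representation of $(A,\cdot,\alpha)$. Then there exists a compatible Hom-M-dendriform algebra structure $(A,\blacktriangleright,\blacktriangleleft,\alpha)$ on $(A,\cdot,\alpha)$ (i.e. with $x\cdot y=x\blacktriangleleft y+x\blacktriangleright y$) given for all $x,y,z\in A$ by $$\mathcal{B}(x\blacktriangleright y,\alpha(z))=\mathcal{B}(\alpha(x),z\cdot y),\qquad \mathcal{B}(x\blacktriangleleft y,\alpha(z))=-\mathcal{B}(\alpha(y),[x,z]).$$
   Context: All vector spaces are over a field $\mathbb{K}$ of characteristic $0$. A Hom-pre-Malcev algebra is a triple $(A,\cdot,\alpha)$ consisting of a vector space $A$, a bilinear product $\cdot:A\times A\to A$ and a linear map $\alpha:A\to A$ such that for all $x,y,z,t\in A$, with $[x,y]=x\cdot y-y\cdot x$, $$\alpha([y,z])\cdot\alpha(x\cdot t)+[[x,y],\alpha(z)]\cdot\alpha^2(t)+\alpha^2(y)\cdot([x,z]\cdot\alpha(t))-\alpha^2(x)\cdot(\alpha(y)\cdot(z\cdot t))+\alpha^2(z)\cdot(\alpha(x)\cdot(y\cdot t))=0.$$ It is regular if $\alpha$ is invertible. A Hessian structure on a regular Hom-pre-Malcev algebra $(A,\cdot,\alpha)$ is a symmetric nondegenerate bilinear form $\mathcal{B}:A\times A\to\mathbb{K}$ such that for all $x,y,z\in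 A$: $\mathcal{B}(\alpha(x),\alpha(y))=\mathcal{B}(x,y)$ and $\mathcal{B}(x\cdot y,\alpha(z))-\mathcal{B}(\alpha(x),y\cdot z)=\mathcal{B}(y\cdot x,\alpha(z))-\mathcal{B}(\alpha(y),x\cdot z)$. Nondegenerate means that $A\to A^*$, $x\mapsto\mathcal{B}(x,-)$ is a linear isomorphism. A representation of $(A,\cdot,\alpha)$ is a quadruple $(V,\ell,r,\beta)$, where $V$ is a vector space, $\beta\in \mathrm{End}(V)$ and $\ell,r:A\to \mathrm{End}(V)$ are linear maps such that, with $\rho=\ell-r$, for all $x,y,z\in A$: $$\ell(\alpha(x))\beta=\beta\ell(x),\qquad r(\alpha(x))\beta=\beta r(x),$$ $$\ell([[x,y],\alpha(z)])\beta^2=\ell(\alpha^2(x))\ell(\alpha(y))\ell(z)-\ell(\alpha^2(z))\ell(\alpha(x))\ell(y)+\ell(\alpha^2(y))\ell([z,x])\beta-\ell(\alpha([y,z]))\ell(\alpha(x))\beta,$$ $$r(\alpha^2(x))\rho(\alpha(y))\rho(z)-r(\alpha(z)\cdot(y\cdot x))\beta^2+\ell(\alpha^2(y))r(z\cdot x)\beta+\ell(\alpha([z,y]))r(\alpha(x))\beta-\ell(\alpha^2(z))r(\alpha(x))\rho(y)=0,$$ $$\ell(\alpha^2(y))\ell(\alpha(z))r(x)-r(\alpha^2(x))\rho(\alpha(y))\rho(z)-\ell(\alpha^2(z))r(y\cdot x)\beta-r(\alpha(z\cdot x))\rho(\alpha(y))\beta+r([z,y]\cdot\alpha(x))\beta^2=0,$$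 $$r(\alpha(y)\cdot(z\cdot x))\beta^2+r(\alpha^2(x))\rho([y,z])\beta-\ell(\alpha^2(y))\ell(\alpha(z))r(x)+r(\alpha(y\cdot x))\rho(\alpha(z))\beta+\ell(\alpha^2(z))r(\alpha(x))\rho(y)=0.$$ Here $\mathrm{ad}(x)(y)=[x,y]$ and $R_\cdot(x)(y)=y\cdot x$. For linear $f:A\to \mathrm{End}(A)$, $f^*:A\to \mathrm{End}(A^* )$ is given by $\langle f^*(x)(\xi),a\rangle=-\langle\xi,f(x)(a)\rangle$, and $f^\star(x)(\xi)=f^*(\alpha(x))\big((\alpha^{-2})^*(\xi)\big)$, where for an endomorphism $g$ of $A$, $g^*$ is its transpose $\langle g^*(\xi),a\rangle=\langle\xi,g(a)\rangle$. A Hom-M-dendriform algebra $(A,\blacktriangleright,\blacktriangleleft,\alpha)$ is a vector space $A$ with two bilinear products $\blacktriangleright,\blacktriangleleft:A\times A\to A$ and a linear map $\alpha:A\to A$ such that, writing $x\cdot y=x\blacktriangleleft y+x\blacktriangleright y$, $x\diamond y=x\blacktriangleleft y-y\blacktriangleright x$, $[x,y]=x\cdot y-y\cdot x=x\diamond y-y\diamond x$, for all $x,y,z,t\in A$: $$(\alpha(z)\diamond(y\diamond x))\blacktriangleright\alpha^2(t)-\alpha^2(x)\blacktriangleright(\alpha(y)\cdot(z\cdot t))+\alpha^2(z)\blacktriangleleft(\alpha(x)\blacktriangleright(y\cdot t))+\alpha([y,z])\blacktriangleleft\alpha(x\blacktriangleright t)-\alpha^2(y)\blacktriangleleft((z\diamond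 x)\blacktriangleright\alpha(t))=0,$$ $$\alpha^2(z)\blacktriangleleft(\alpha(x)\blacktriangleleft(y\blacktriangleright t))-(\alpha(z)\diamond(x\diamond y))\blacktriangleright\alpha^2(t)-\alpha^2(x)\blacktriangleleft(\alpha(y)\blacktriangleright(z\cdot t))-\alpha(z\diamond y)\blacktriangleright\alpha(x\cdot t)+\alpha^2(y)\blacktriangleright([x,z]\cdot\alpha(t))=0,$$ $$\alpha^2(z)\blacktriangleright(\alpha(x)\cdot(y\cdot t))+([x,y]\diamond\alpha(z))\blacktriangleright\alpha^2(t)-\alpha^2(x)\blacktriangleleft(\alpha(y)\blacktriangleleft(z\blacktriangleright t))+\alpha(y\diamond z)\blacktriangleright\alpha(x\cdot t)+\alpha^2(y)\blacktriangleleft((x\diamond z)\blacktriangleright\alpha(t))=0,$$ $$[[x,y],\alpha(z)]\blacktriangleleft\alpha^2(t)-\alpha^2(x)\blacktriangleleft(\alpha(y)\blacktriangleleft(z\blacktriangleleft t))+\alpha^2(z)\blacktriangleleft(\alpha(x)\blacktriangleleft(y\blacktriangleleft t))+\alpha([y,z])\blacktriangleleft\alpha(x\blacktriangleleft t)+\alpha^2(y)\blacktriangleleft([x,z]\blacktriangleleft\alpha(t))=0.$$ *)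

theory Defs
  imports Complex_Main "HOL-Library.Function_Algebras"
begin

definition bilinear_map ::
  "('k::field \<Rightarrow> 'a::ab_group_add \<Rightarrow> 'a) \<Rightarrow> ('k \<Rightarrow> 'b::ab_group_add \<Rightarrow> 'b) \<Rightarrow> ('a \<Rightarrow> 'a \<Rightarrow> 'b) \<Rightarrow> bool"
  where "bilinear_map s t f \<longleftrightarrow>
    (\<forall>x. Vector_Spaces.linear s t (f x)) \<and> (\<forall>y. Vector_Spaces.linear s t (\<lambda>x. f x y))"

definition commutator :: "('a::ab_group_add \<Rightarrow> 'a \<Rightarrow> 'a) \<Rightarrow> 'a \<Rightarrow> 'a \<Rightarrow> 'a"
  where "commutator m x y = m x y - m y x"

definition right_mult :: "('a \<Rightarrow> 'a \<Rightarrow> 'a) \<Rightarrow> 'a \<Rightarrow> 'a \<Rightarrow> 'a"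
  where "right_mult m x y = m y x"


locale hom_algebra = vector_space scale
  for scale :: "'k::field_char_0 \<Rightarrow> 'a::ab_group_add \<Rightarrow> 'a" +
  fixes mul :: "'a \<Rightarrow> 'a \<Rightarrow> 'a" (infixl \<open>\<cdot>\<close> 70)
    and \<alpha> :: "'a \<Rightarrow> 'a"
  assumes bilinear_mul: "bilinear_map scale scale mul"
    and linear_twist: "Vector_Spaces.linear scale scale \<alpha>"
begin

abbreviation bracket (\<open>\<lbrace>_,/ _\<rbrace>\<close>)
  where "\<lbrace>x, y\<rbrace> \<equiv> commutator mul x y"

end

locale hom_pre_malcev = hom_algebra +
  assumes hom_pre_malcev:
    "\<alpha> \<lbrace>y, z\<rbrace> \<cdot> \<alpha> (x \<cdot> t) + \<lbrace>\<lbrace>x, y\<rbrace>, \<alpha> z\<rbrace> \<cdot> \<alpha> (\<alpha> t) + \<alpha> (\<alpha> y) \<cdot> (\<lbrace>x, z\<rbrace> \<cdot> \<alpha> t)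
      - \<alpha> (\<alpha> x) \<cdot> (\<alpha> y \<cdot> (z \<cdot> t)) + \<alpha> (\<alpha> z) \<cdot> (\<alpha> x \<cdot> (y \<cdot> t)) = 0"

locale regular_hom_pre_malcev = hom_pre_malcev +
  assumes bij_twist: "bij \<alpha>"


text \<open>The dual space consists of the linear functionals inside the space of all functions
  \<open>'a \<Rightarrow> 'k\<close>, with the pointwise operations.\<close>

definition dual_space :: "('k::field \<Rightarrow> 'a::ab_group_add \<Rightarrow> 'a) \<Rightarrow> ('a \<Rightarrow> 'k) set"
  where "dual_space s = {\<xi>. Vector_Spaces.linear s (*) \<xi>}"

definition fun_scale :: "'k::field \<Rightarrow> ('a \<Rightarrow> 'k) \<Rightarrow> 'a \<Rightarrow> 'k"
  where "fun_scale c \<xi> = (\<lambda>a. c * \<xi> a)"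

lemma vector_space_fun_scale: "vector_space fun_scale"
  by standard (auto simp: fun_scale_def fun_eq_iff algebra_simps)

lemma subspace_dual_space:
  assumes "vector_space s"
  shows "module.subspace fun_scale (dual_space s)"
proof -
  interpret F: vector_space fun_scale by (rule vector_space_fun_scale)
  have K: "vector_space ((*) :: 'a \<Rightarrow> 'a \<Rightarrow> 'a)"
    by standard (simp_all add: algebra_simps)
  have mem: "\<xi> \<in> dual_space s \<longleftrightarrow>
      (\<forall>x y. \<xi> (x + y) = \<xi> x + \<xi> y) \<and> (\<forall>c x. \<xi> (s c x) = c * \<xi> x)" for \<xi>
    using assms K by (auto simp: dual_space_def Vector_Spaces.linear_iff)
  show ?thesis
    by (simp add: F.subspace_def mem fun_scale_def distrib_left mult.left_commute add.assoc
        add.left_commute)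
qed

text \<open>The map \<open>f\<^sup>* : A \<rightarrow> End(A\<^sup>*)\<close> for \<open>f : A \<rightarrow> End(A)\<close>, and the transpose \<open>g\<^sup>*\<close>
  of an endomorphism \<open>g\<close>; they differ in sign.\<close>

definition dual_action :: "('a \<Rightarrow> 'a \<Rightarrow> 'a) \<Rightarrow> 'a \<Rightarrow> ('a \<Rightarrow> 'k::field) \<Rightarrow> 'a \<Rightarrow> 'k"
  where "dual_action f x \<xi> = (\<lambda>a. - \<xi> (f x a))"

definition transpose_map :: "('a \<Rightarrow> 'a) \<Rightarrow> ('a \<Rightarrow> 'k) \<Rightarrow> 'a \<Rightarrow> 'k"
  where "transpose_map g \<xi> = (\<lambda>a. \<xi> (g a))"

text \<open>The twisted dual \<open>f\<^sup>\<star>\<close>.\<close>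

definition twisted_dual_action ::
  "('a \<Rightarrow> 'a) \<Rightarrow> ('a \<Rightarrow> 'a \<Rightarrow> 'a) \<Rightarrow> 'a \<Rightarrow> ('a \<Rightarrow> 'k::field) \<Rightarrow> 'a \<Rightarrow> 'k"
  where "twisted_dual_action \<alpha> f x \<xi> =
    dual_action f (\<alpha> x) (transpose_map (inv \<alpha> \<circ> inv \<alpha>) \<xi>)"


text \<open>Nondegeneracy asks that \<open>x \<mapsto> \<B>(x, -)\<close> be an isomorphism onto the dual space; its
  linearity is part of bilinearity, so bijectivity remains.\<close>

locale hessian_structure = regular_hom_pre_malcev scale mul \<alpha>
  for scale :: "'k::field_char_0 \<Rightarrow> 'a::ab_group_add \<Rightarrow> 'a"
    and mul :: "'a \<Rightarrow> 'a \<Rightarrow> 'a" (infixl \<open>\<cdot>\<close> 70)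
    and \<alpha> :: "'a \<Rightarrow> 'a" +
  fixes \<B> :: "'a \<Rightarrow> 'a \<Rightarrow> 'k"
  assumes bilinear_form: "bilinear_map scale (*) \<B>"
    and symmetric: "\<B> x y = \<B> y x"
    and nondegenerate: "bij_betw (\<lambda>x. \<B> x) UNIV (dual_space scale)"
    and twist_invariant: "\<B> (\<alpha> x) (\<alpha> y) = \<B> x y"
    and hessian:
      "\<B> (x \<cdot> y) (\<alpha> z) - \<B> (\<alpha> x) (y \<cdot> z) = \<B> (y \<cdot> x) (\<alpha> z) - \<B> (\<alpha> y) (x \<cdot> z)"


text \<open>The representation space is a subspace \<open>V\<close> of an ambient vector space, so that the dual
  space is an instance. The values of operators outside \<open>V\<close> are irrelevant.\<close>

definition endo_on ::
  "('k::field \<Rightarrow> 'v::ab_group_add \<Rightarrow> 'v) \<Rightarrow> 'v set \<Rightarrow> ('v \<Rightarrow> 'v) \<Rightarrow> bool"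
  where "endo_on s V f \<longleftrightarrow> f ` V \<subseteq> V \<and> (\<forall>u\<in>V. \<forall>v\<in>V. f (u + v) = f u + f v) \<and>
    (\<forall>c. \<forall>v\<in>V. f (s c v) = s c (f v))"

definition linear_into_endo_on ::
  "('k::field \<Rightarrow> 'a::ab_group_add \<Rightarrow> 'a) \<Rightarrow> ('k \<Rightarrow> 'v::ab_group_add \<Rightarrow> 'v) \<Rightarrow> 'v set \<Rightarrow>
    ('a \<Rightarrow> 'v \<Rightarrow> 'v) \<Rightarrow> bool"
  where "linear_into_endo_on s t V f \<longleftrightarrow> (\<forall>x. endo_on t V (f x)) \<and>
    (\<forall>x y. \<forall>v\<in>V. f (x + y) v = f x v + f y v) \<and> (\<forall>c x. \<forall>v\<in>V. f (s c x) v = t c (f x v))"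

locale hom_pre_malcev_representation =
  hom_pre_malcev scale mul \<alpha> + V: vector_space scaleV
  for scale :: "'k::field_char_0 \<Rightarrow> 'a::ab_group_add \<Rightarrow> 'a"
    and mul :: "'a \<Rightarrow> 'a \<Rightarrow> 'a" (infixl \<open>\<cdot>\<close> 70)
    and \<alpha> :: "'a \<Rightarrow> 'a"
    and scaleV :: "'k \<Rightarrow> 'v::ab_group_add \<Rightarrow> 'v" +
  fixes V :: "'v set"
    and l r :: "'a \<Rightarrow> 'v \<Rightarrow> 'v"
    and \<beta> :: "'v \<Rightarrow> 'v"
    and \<rho> :: "'a \<Rightarrow> 'v \<Rightarrow> 'v"
  defines "\<rho> x v \<equiv> l x v - r x v"
  assumes subspace: "V.subspace V"
    and endo_\<beta>: "endo_on scaleV V \<beta>"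
    and linear_l: "linear_into_endo_on scale scaleV V l"
    and linear_r: "linear_into_endo_on scale scaleV V r"
    and l_twist: "v \<in> V \<Longrightarrow> l (\<alpha> x) (\<beta> v) = \<beta> (l x v)"
    and r_twist: "v \<in> V \<Longrightarrow> r (\<alpha> x) (\<beta> v) = \<beta> (r x v)"
    and rep1: "v \<in> V \<Longrightarrow> l \<lbrace>\<lbrace>x, y\<rbrace>, \<alpha> z\<rbrace> (\<beta> (\<beta> v)) =
        l (\<alpha> (\<alpha> x)) (l (\<alpha> y) (l z v)) - l (\<alpha> (\<alpha> z)) (l (\<alpha> x) (l y v))
        + l (\<alpha> (\<alpha> y)) (l \<lbrace>z, x\<rbrace> (\<beta> v)) - l (\<alpha> \<lbrace>y, z\<rbrace>) (l (\<alpha> x) (\<beta> v))"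
    and rep2: "v \<in> V \<Longrightarrow>
        r (\<alpha> (\<alpha> x)) (\<rho> (\<alpha> y) (\<rho> z v)) - r (\<alpha> z \<cdot> (y \<cdot> x)) (\<beta> (\<beta> v))
        + l (\<alpha> (\<alpha> y)) (r (z \<cdot> x) (\<beta> v)) + l (\<alpha> \<lbrace>z, y\<rbrace>) (r (\<alpha> x) (\<beta> v))
        - l (\<alpha> (\<alpha> z)) (r (\<alpha> x) (\<rho> y v)) = 0"
    and rep3: "v \<in> V \<Longrightarrow>
        l (\<alpha> (\<alpha> y)) (l (\<alpha> z) (r x v)) - r (\<alpha> (\<alpha> x)) (\<rho> (\<alpha> y) (\<rho> z v))
        - l (\<alpha> (\<alpha> z)) (r (y \<cdot> x) (\<beta> v)) - r (\<alpha> (z \<cdot> x)) (\<rho> (\<alpha> y) (\<beta> v))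
        + r (\<lbrace>z, y\<rbrace> \<cdot> \<alpha> x) (\<beta> (\<beta> v)) = 0"
    and rep4: "v \<in> V \<Longrightarrow>
        r (\<alpha> y \<cdot> (z \<cdot> x)) (\<beta> (\<beta> v)) + r (\<alpha> (\<alpha> x)) (\<rho> \<lbrace>y, z\<rbrace> (\<beta> v))
        - l (\<alpha> (\<alpha> y)) (l (\<alpha> z) (r x v)) + r (\<alpha> (y \<cdot> x)) (\<rho> (\<alpha> z) (\<beta> v))
        + l (\<alpha> (\<alpha> z)) (r (\<alpha> x) (\<rho> y v)) = 0"


locale hom_M_dendriform_ops = vector_space scale
  for scale :: "'k::field_char_0 \<Rightarrow> 'a::ab_group_add \<Rightarrow> 'a" +
  fixes rtri :: "'a \<Rightarrow> 'a \<Rightarrow> 'a" (infixl \<open>\<triangleright>\<close> 70)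
    and ltri :: "'a \<Rightarrow> 'a \<Rightarrow> 'a" (infixl \<open>\<triangleleft>\<close> 70)
    and \<alpha> :: "'a \<Rightarrow> 'a"
  assumes bilinear_rtri: "bilinear_map scale scale rtri"
    and bilinear_ltri: "bilinear_map scale scale ltri"
    and linear_twist: "Vector_Spaces.linear scale scale \<alpha>"
begin

definition dot (infixl \<open>\<cdot>\<close> 70)
  where "x \<cdot> y = x \<triangleleft> y + x \<triangleright> y"

definition diam (infixl \<open>\<diamondop>\<close> 70)
  where "x \<diamondop> y = x \<triangleleft> y - y \<triangleright> x"

abbreviation bracket (\<open>\<lbrace>_,/ _\<rbrace>\<close>)
  where "\<lbrace>x, y\<rbrace> \<equiv> commutator dot x y"

lemma bracket_eq_commutator_diam: "\<lbrace>x, y\<rbrace> = commutator diam x y"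
  by (simp add: commutator_def dot_def diam_def)

end

locale hom_M_dendriform = hom_M_dendriform_ops +
  assumes dendriform1:
      "(\<alpha> z \<diamondop> (y \<diamondop> x)) \<triangleright> \<alpha> (\<alpha> t) - \<alpha> (\<alpha> x) \<triangleright> (\<alpha> y \<cdot> (z \<cdot> t))
        + \<alpha> (\<alpha> z) \<triangleleft> (\<alpha> x \<triangleright> (y \<cdot> t)) + \<alpha> \<lbrace>y, z\<rbrace> \<triangleleft> \<alpha> (x \<triangleright> t)
        - \<alpha> (\<alpha> y) \<triangleleft> ((z \<diamondop> x) \<triangleright> \<alpha> t) = 0"
    and dendriform2:
      "\<alpha> (\<alpha> z) \<triangleleft> (\<alpha> x \<triangleleft> (y \<triangleright> t)) - (\<alpha> z \<diamondop> (x \<diamondop> y)) \<triangleright> \<alpha> (\<alpha> t)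
        - \<alpha> (\<alpha> x) \<triangleleft> (\<alpha> y \<triangleright> (z \<cdot> t)) - \<alpha> (z \<diamondop> y) \<triangleright> \<alpha> (x \<cdot> t)
        + \<alpha> (\<alpha> y) \<triangleright> (\<lbrace>x, z\<rbrace> \<cdot> \<alpha> t) = 0"
    and dendriform3:
      "\<alpha> (\<alpha> z) \<triangleright> (\<alpha> x \<cdot> (y \<cdot> t)) + (\<lbrace>x, y\<rbrace> \<diamondop> \<alpha> z) \<triangleright> \<alpha> (\<alpha> t)
        - \<alpha> (\<alpha> x) \<triangleleft> (\<alpha> y \<triangleleft> (z \<triangleright> t)) + \<alpha> (y \<diamondop> z) \<triangleright> \<alpha> (x \<cdot> t)
        + \<alpha> (\<alpha> y) \<triangleleft> ((x \<diamondop> z) \<triangleright> \<alpha> t) = 0"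
    and dendriform4:
      "\<lbrace>\<lbrace>x, y\<rbrace>, \<alpha> z\<rbrace> \<triangleleft> \<alpha> (\<alpha> t) - \<alpha> (\<alpha> x) \<triangleleft> (\<alpha> y \<triangleleft> (z \<triangleleft> t))
        + \<alpha> (\<alpha> z) \<triangleleft> (\<alpha> x \<triangleleft> (y \<triangleleft> t)) + \<alpha> \<lbrace>y, z\<rbrace> \<triangleleft> \<alpha> (x \<triangleleft> t)
        + \<alpha> (\<alpha> y) \<triangleleft> (\<lbrace>x, z\<rbrace> \<triangleleft> \<alpha> t) = 0"

end

theory Submission
  imports Defs
begin

text \<open>
  The form identifies the algebra with its dual: put \<open>\<Phi> x = \<B> x\<close>, a linear isomorphism
  \<open>A \<rightarrow> A\<^sup>*\<close>, and transport the given representation \<open>(l, r, \<beta>)\<close> along it. Invariance of \<open>\<B>\<close>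
  turns \<open>\<beta> = (\<alpha>\<^sup>-\<^sup>1)\<^sup>*\<close> into \<open>\<alpha>\<close>, and the products of the theorem are the transported operators
  \<open>x \<triangleleft> y = l x y\<close> and \<open>x \<triangleright> y = r y x\<close>, so that \<open>x \<diamondop> y = \<rho> x y\<close>. Under this dictionary the
  four identities of a representation are, up to renaming of the variables, the four identities
  of a Hom-M-dendriform algebra, provided the operators add up to the given product
  (\<open>hom_M_dendriform_of_equivariant_iso\<close>). That they do is the Hessian identity
  (\<open>hessian_decomposition\<close>).

  One point is hidden in the notation. The twisted duals are built from \<open>\<alpha> x\<close> and
  \<open>\<alpha>\<^sup>-\<^sup>2\<close>, whereas the formulas for the products contain a single \<open>\<alpha>\<close>; the two agree only if
  \<open>\<alpha>\<close> is an algebra endomorphism. The axioms of a Hom-pre-Malcev algebra do not say so, but the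
  compatibility of \<open>-R\<^sup>\<star>\<close> with \<open>\<beta>\<close> forces it (\<open>twist_mul\<close>).
\<close>

context hom_pre_malcev_representation
begin

lemma action_closed: "v \<in> V \<Longrightarrow> l x v \<in> V" "v \<in> V \<Longrightarrow> r x v \<in> V"
  using linear_l linear_r by (auto simp: linear_into_endo_on_def endo_on_def image_subset_iff)

text \<open>Each identity of the representation, taken at \<open>v = \<Phi> t\<close>, is \<open>\<Phi>\<close> of an expression in \<open>t\<close> and
  the algebra elements \<open>x, y, z\<close>; injectivity of \<open>\<Phi>\<close> turns it into a dendriform identity. The
  compatibility of \<open>l\<close> and \<open>r\<close> with \<open>\<beta>\<close> becomes multiplicativity of \<open>\<alpha>\<close> for both new products,
  which reconciles \<open>\<alpha> x \<triangleleft> \<alpha> t\<close>, coming from a representation, with the \<open>\<alpha> (x \<triangleleft> t)\<close> of the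
  dendriform identities.\<close>

lemma hom_M_dendriform_of_equivariant_iso:
  fixes \<Phi> :: "'a \<Rightarrow> 'v" and rtri ltri :: "'a \<Rightarrow> 'a \<Rightarrow> 'a"
  assumes lin: "Vector_Spaces.linear scale scaleV \<Phi>"
    and inj: "inj \<Phi>" and into: "\<And>x. \<Phi> x \<in> V"
    and \<Phi>_twist: "\<And>x. \<Phi> (\<alpha> x) = \<beta> (\<Phi> x)"
    and \<Phi>_rtri: "\<And>x y. \<Phi> (rtri x y) = r y (\<Phi> x)"
    and \<Phi>_ltri: "\<And>x y. \<Phi> (ltri x y) = l x (\<Phi> y)"
    and decomp: "\<And>x y. x \<cdot> y = ltri x y + rtri x y"
  shows "hom_M_dendriform scale rtri ltri \<alpha>"
proof -
  interpret \<Phi>: Vector_Spaces.linear scale scaleV \<Phi> by (rule lin)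
  have eqI: "a = b" if "\<Phi> a = \<Phi> b" for a b
    using inj that by (rule injD)
  have l_lin: "l x (u + v) = l x u + l x v" "l x (scaleV c u) = scaleV c (l x u)"
      "l (x + y) u = l x u + l y u" "l (scale c x) u = scaleV c (l x u)"
    if "u \<in> V" "v \<in> V" for x y c u v
    using linear_l that unfolding linear_into_endo_on_def endo_on_def by auto
  have r_lin: "r x (u + v) = r x u + r x v" "r x (scaleV c u) = scaleV c (r x u)"
      "r (x + y) u = r x u + r y u" "r (scale c x) u = scaleV c (r x u)"
    if "u \<in> V" "v \<in> V" for x y c u v
    using linear_r that unfolding linear_into_endo_on_def endo_on_def by auto
  note lins = l_lin[OF into into] r_lin[OF into into]
  note \<Phi>_ops = \<Phi>_rtri \<Phi>_ltri \<Phi>.add \<Phi>.scale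
  have bil_r: "bilinear_map scale scale rtri"
    unfolding bilinear_map_def Vector_Spaces.linear_iff
    by (auto intro!: eqI vector_space_axioms simp: \<Phi>_ops lins)
  have bil_l: "bilinear_map scale scale ltri"
    unfolding bilinear_map_def Vector_Spaces.linear_iff
    by (auto intro!: eqI vector_space_axioms simp: \<Phi>_ops lins)
  interpret D: hom_M_dendriform_ops scale rtri ltri \<alpha>
    by (intro hom_M_dendriform_ops.intro hom_M_dendriform_ops_axioms.intro
        vector_space_axioms bil_r bil_l linear_twist)
  have dot: "D.dot = mul"
    by (intro ext) (simp add: D.dot_def decomp)
  have twist: "rtri (\<alpha> x) (\<alpha> y) = \<alpha> (rtri x y)" "ltri (\<alpha> x) (\<alpha> y) = \<alpha> (ltri x y)" for x y
    by (auto intro!: eqI simp: \<Phi>_ops \<Phi>_twist l_twist r_twist into)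
  interpret A: Vector_Spaces.linear scale scale \<alpha> by (rule linear_twist)
  have diam_twist: "D.diam (\<alpha> x) (\<alpha> y) = \<alpha> (D.diam x y)" for x y
    by (simp add: D.diam_def twist A.diff)
  have fold_\<Phi>: "r y (\<Phi> x) = \<Phi> (rtri x y)" "l x (\<Phi> y) = \<Phi> (ltri x y)" "\<beta> (\<Phi> x) = \<Phi> (\<alpha> x)"
      "\<rho> x (\<Phi> y) = \<Phi> (D.diam x y)" "\<Phi> x + \<Phi> y = \<Phi> (x + y)" "\<Phi> x - \<Phi> y = \<Phi> (x - y)" for x y
    by (simp_all add: \<Phi>_ops \<Phi>_twist \<rho>_def D.diam_def \<Phi>.diff)
  have \<Phi>_eq: "\<Phi> x = \<Phi> y \<longleftrightarrow> x = y" "\<Phi> x = 0 \<longleftrightarrow> x = 0" for x y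
    using inj \<Phi>.zero by (metis injD)+
  note pull_back = fold_\<Phi> \<Phi>_eq twist diam_twist
  (* The fourth dendriform identity has the bracket [x, z] where the representation has [z, x]. *)
  have ltri_minus: "ltri a (ltri (commutator mul z x) b) = - ltri a (ltri (commutator mul x z) b)"
    for a b x z
  proof -
    interpret a: Vector_Spaces.linear scale scale "ltri a"
      using bil_l by (simp add: bilinear_map_def)
    interpret b: Vector_Spaces.linear scale scale "\<lambda>u. ltri u b"
      using bil_l by (simp add: bilinear_map_def)
    show ?thesis
      using b.neg[of "commutator mul x z"] by (simp add: commutator_def a.neg)
  qed
  show ?thesis
  proof unfold_locales
    fix x y z t
    show "rtri (D.diam (\<alpha> z) (D.diam y x)) (\<alpha> (\<alpha> t)) - rtri (\<alpha> (\<alpha> x)) (D.dot (\<alpha> y) (D.dot z t))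
        + ltri (\<alpha> (\<alpha> z)) (rtri (\<alpha> x) (D.dot y t)) + ltri (\<alpha> (commutator D.dot y z)) (\<alpha> (rtri x t))
        - ltri (\<alpha> (\<alpha> y)) (rtri (D.diam z x) (\<alpha> t)) = 0"
      using rep2[OF into, where x=t and y=z and z=y, of x] by (simp add: dot pull_back)
    show "ltri (\<alpha> (\<alpha> z)) (ltri (\<alpha> x) (rtri y t)) - rtri (D.diam (\<alpha> z) (D.diam x y)) (\<alpha> (\<alpha> t))
        - ltri (\<alpha> (\<alpha> x)) (rtri (\<alpha> y) (D.dot z t)) - rtri (\<alpha> (D.diam z y)) (\<alpha> (D.dot x t))
        + rtri (\<alpha> (\<alpha> y)) (D.dot (commutator D.dot x z) (\<alpha> t)) = 0"
      using rep3[OF into, where x=t and y=z and z=x, of y] by (simp add: dot pull_back)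
    show "rtri (\<alpha> (\<alpha> z)) (D.dot (\<alpha> x) (D.dot y t))
        + rtri (D.diam (commutator D.dot x y) (\<alpha> z)) (\<alpha> (\<alpha> t))
        - ltri (\<alpha> (\<alpha> x)) (ltri (\<alpha> y) (rtri z t)) + rtri (\<alpha> (D.diam y z)) (\<alpha> (D.dot x t))
        + ltri (\<alpha> (\<alpha> y)) (rtri (D.diam x z) (\<alpha> t)) = 0"
      using rep4[OF into, where x=t and y=x and z=y, of z] by (simp add: dot pull_back)
    show "ltri (commutator D.dot (commutator D.dot x y) (\<alpha> z)) (\<alpha> (\<alpha> t))
        - ltri (\<alpha> (\<alpha> x)) (ltri (\<alpha> y) (ltri z t)) + ltri (\<alpha> (\<alpha> z)) (ltri (\<alpha> x) (ltri y t))
        + ltri (\<alpha> (commutator D.dot y z)) (\<alpha> (ltri x t))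
        + ltri (\<alpha> (\<alpha> y)) (ltri (commutator D.dot x z) (\<alpha> t)) = 0"
      using rep1[OF into, where x=x and y=y and z=z, of t]
      by (simp add: dot pull_back ltri_minus[of _ z x])
  qed
qed

end

context hessian_structure
begin

lemma form_mem_dual: "\<B> x \<in> dual_space scale"
  using nondegenerate by (auto simp: bij_betw_def)

lemma form_inj: "inj \<B>"
  using nondegenerate by (simp add: bij_betw_def)

lemma form_linear: "Vector_Spaces.linear scale fun_scale \<B>"
  using bilinear_form vector_space_fun_scale
  by (auto simp: bilinear_map_def Vector_Spaces.linear_iff fun_scale_def fun_eq_iff)

lemma form_eqI: "u = v" if "\<And>w. \<B> w u = \<B> w v"
  using that form_inj by (auto simp: inj_def fun_eq_iff symmetric[of _ u] symmetric[of _ v])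

lemma form_inv_twist: "\<B> u (inv \<alpha> w) = \<B> (\<alpha> u) w"
  by (metis twist_invariant bij_twist bij_inv_eq_iff)

text \<open>The two summands on the right are the values on \<open>\<alpha> z\<close> of \<open>x \<triangleleft> y\<close> and \<open>x \<triangleright> y\<close>: the Hessian
  identity, read with the roles of its last two arguments exchanged, splits the product.\<close>

lemma hessian_decomposition:
  "\<B> (x \<cdot> y) (\<alpha> z) = - \<B> (\<alpha> y) \<lbrace>x, z\<rbrace> + \<B> (\<alpha> x) (z \<cdot> y)"
proof -
  interpret y: Vector_Spaces.linear scale "(*)" "\<B> (\<alpha> y)"
    using bilinear_form by (simp add: bilinear_map_def)
  show ?thesis
    using hessian[of x z y]
    by (simp add: commutator_def y.diff symmetric[of "_ \<cdot> _"] algebra_simps)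
qed

end

theorem proposition4p5:
  fixes scale :: "'k::field_char_0 \<Rightarrow> 'a::ab_group_add \<Rightarrow> 'a"
    and mul :: "'a \<Rightarrow> 'a \<Rightarrow> 'a" (infixl \<open>\<cdot>\<close> 70)
    and \<alpha> :: "'a \<Rightarrow> 'a"
    and \<B> :: "'a \<Rightarrow> 'a \<Rightarrow> 'k"
  assumes "regular_hom_pre_malcev scale mul \<alpha>"
    and "hessian_structure scale mul \<alpha> \<B>"
    and "hom_pre_malcev_representation scale mul \<alpha> fun_scale (dual_space scale)
      (twisted_dual_action \<alpha> (commutator mul))
      (\<lambda>x \<xi>. - twisted_dual_action \<alpha> (right_mult mul) x \<xi>)
      (transpose_map (inv \<alpha>))"
  shows "\<exists>rtri ltri. hom_M_dendriform scale rtri ltri \<alpha> \<and>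
    (\<forall>x y. x \<cdot> y = ltri x y + rtri x y) \<and>
    (\<forall>x y z. \<B> (rtri x y) (\<alpha> z) = \<B> (\<alpha> x) (z \<cdot> y)) \<and>
    (\<forall>x y z. \<B> (ltri x y) (\<alpha> z) = - \<B> (\<alpha> y) (commutator mul x z))"
proof -
  interpret H: hessian_structure scale mul \<alpha> \<B> by (rule assms(2))
  let ?l = "twisted_dual_action \<alpha> (commutator mul) :: 'a \<Rightarrow> ('a \<Rightarrow> 'k) \<Rightarrow> 'a \<Rightarrow> 'k"
  let ?r = "\<lambda>x \<xi>. - twisted_dual_action \<alpha> (right_mult mul) x \<xi> :: 'a \<Rightarrow> 'k"
  interpret R: hom_pre_malcev_representation scale mul \<alpha> fun_scale "dual_space scale" ?l ?r
      "transpose_map (inv \<alpha>)" "\<lambda>x \<xi>. ?l x \<xi> - ?r x \<xi>"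
    by (rule assms(3), rule reflexive)
  have inv_twist [simp]: "inv \<alpha> (\<alpha> x) = x" "\<alpha> (inv \<alpha> x) = x" for x
    using H.bij_twist by (simp_all add: bij_is_inj bij_is_surj surj_f_inv_f)
  have l_form: "?l x (\<B> y) w = - \<B> (\<alpha> (\<alpha> y)) (commutator mul (\<alpha> x) w)" for x y w
    by (simp add: twisted_dual_action_def dual_action_def transpose_map_def H.form_inv_twist)
  have r_form: "?r x (\<B> y) w = \<B> (\<alpha> (\<alpha> y)) (w \<cdot> \<alpha> x)" for x y w
    by (simp add: twisted_dual_action_def dual_action_def transpose_map_def H.form_inv_twist
        right_mult_def)
  have \<beta>_form: "transpose_map (inv \<alpha>) (\<B> y) = \<B> (\<alpha> y)" for y
    by (simp add: fun_eq_iff transpose_map_def H.form_inv_twist)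
  have twist_mul: "\<alpha> (a \<cdot> b) = \<alpha> a \<cdot> \<alpha> b" for a b
  proof (rule H.form_eqI)
    fix u
    (* An arbitrary u is \<alpha>\<^sup>3 y and b is \<alpha> x; the compatibility of r with \<beta> at \<B> y, evaluated at
       \<alpha> a, is the claim paired with u. *)
    define x where "x = inv \<alpha> b"
    define y where "y = inv \<alpha> (inv \<alpha> (inv \<alpha> u))"
    have "?r (\<alpha> x) (\<B> (\<alpha> y)) (\<alpha> a) = ?r x (\<B> y) (inv \<alpha> (\<alpha> a))"
      using R.r_twist[OF H.form_mem_dual, of x y]
      by (simp only: \<beta>_form) (simp only: transpose_map_def)
    then have "\<B> (\<alpha> (\<alpha> (\<alpha> y))) (\<alpha> a \<cdot> \<alpha> (\<alpha> x)) = \<B> (\<alpha> (\<alpha> y)) (a \<cdot> \<alpha> x)"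
      by (simp only: r_form inv_twist)
    then show "\<B> u (\<alpha> (a \<cdot> b)) = \<B> u (\<alpha> a \<cdot> \<alpha> b)"
      using H.twist_invariant[of "\<alpha> (\<alpha> y)" "a \<cdot> b"] by (simp add: x_def y_def)
  qed
  interpret twist: Vector_Spaces.linear scale scale \<alpha> by (rule H.linear_twist)
  interpret form: Vector_Spaces.linear scale fun_scale \<B> by (rule H.form_linear)
  have twist_commutator: "commutator mul (\<alpha> a) (\<alpha> b) = \<alpha> (commutator mul a b)" for a b
    by (simp add: commutator_def twist_mul twist.diff)
  define \<Psi> where "\<Psi> = inv_into UNIV \<B>"
  have \<Psi>: "\<B> (\<Psi> \<xi>) = \<xi>" if "\<xi> \<in> dual_space scale" for \<xi>
    using H.nondegenerate that unfolding \<Psi>_def by (metis bij_betw_def f_inv_into_f)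
  define rtri where "rtri x y = \<Psi> (?r y (\<B> x))" for x y
  define ltri where "ltri x y = \<Psi> (?l x (\<B> y))" for x y
  have \<Phi>_rtri: "\<B> (rtri x y) = ?r y (\<B> x)" for x y
    unfolding rtri_def by (rule \<Psi>[OF R.action_closed(2)[OF H.form_mem_dual]])
  have \<Phi>_ltri: "\<B> (ltri x y) = ?l x (\<B> y)" for x y
    unfolding ltri_def by (rule \<Psi>[OF R.action_closed(1)[OF H.form_mem_dual]])
  have rtri_form: "\<B> (rtri x y) (\<alpha> z) = \<B> (\<alpha> x) (z \<cdot> y)" for x y z
    by (simp only: \<Phi>_rtri r_form twist_mul[symmetric] H.twist_invariant)
  have ltri_form: "\<B> (ltri x y) (\<alpha> z) = - \<B> (\<alpha> y) (commutator mul x z)" for x y z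
    by (simp only: \<Phi>_ltri l_form twist_commutator H.twist_invariant)
  have decomp: "x \<cdot> y = ltri x y + rtri x y" for x y
  proof (rule H.form_eqI)
    fix w
    have "\<B> (x \<cdot> y) (\<alpha> (inv \<alpha> w)) = \<B> (ltri x y + rtri x y) (\<alpha> (inv \<alpha> w))"
      by (simp only: form.add H.hessian_decomposition plus_fun_apply rtri_form ltri_form)
    then show "\<B> w (x \<cdot> y) = \<B> w (ltri x y + rtri x y)"
      by (simp add: H.symmetric[of w])
  qed
  have "hom_M_dendriform scale rtri ltri \<alpha>"
    using H.form_linear H.form_inj H.form_mem_dual \<beta>_form[symmetric] \<Phi>_rtri \<Phi>_ltri decomp
    by (rule R.hom_M_dendriform_of_equivariant_iso)
  then show ?thesis
    using decomp rtri_form ltri_form by blast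
qed

end
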